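(* Let $Y$ be a simple graph on $n$ vertices. The diameter of any connected component of $\mathsf{FS}(\mathsf{Path}_n, Y)$ is at most $|E(Y)|$.
   Context: For simple graphs $X,Y$ on $n$ vertices, $\mathsf{FS}(X,Y)$ has as vertices all bijections $V(X)\to V(Y)$, with $\sigma,\tau$ adjacent iff there is an edge $\{a,b\}\in E(X)$ such that $\{\sigma(a),\sigma(b)\}\in E(Y)$, $\tau(a)=\sigma(b)$, $\tau(b)=\sigma(a)$, and $\tau(c)=\sigma(c)$ for all other $c$. $\mathsf{Path}_n$ is the path on $[n]$ with edges $\{i,i+1\}$. *)

theory Defs
  imports "Graph_Theory.Graph_Theory" "HOL-Library.FuncSet"
begin

text \<open>
  A simple graph is a \<^locale>\<open>pair_graph\<close>: a finite, loopfree, symmetric digraph without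
  parallel arcs. An undirected edge is thus represented by two opposite arcs; the following
  definition recovers the edges as unordered pairs, so that each one is counted once.
\<close>

definition edges :: "'a pair_pre_digraph \<Rightarrow> 'a set set" where
  "edges G = {{u, v} | u v. (u, v) \<in> parcs G}"

definition path_graph :: "nat \<Rightarrow> nat pair_pre_digraph" where
  "path_graph n =
    \<lparr> pverts = {1..n},
      parcs = {(i, j). i \<in> {1..n} \<and> j \<in> {1..n} \<and> (j = i + 1 \<or> i = j + 1)} \<rparr>"

text \<open>
  The functions below are total, so a bijection from \<open>V(X)\<close> to \<open>V(Y)\<close> is
  represented by its unique representative that is \<^const>\<open>undefined\<close> outside \<open>V(X)\<close>.
\<close>

definition bijections :: "'a set \<Rightarrow> 'b set \<Rightarrow> ('a \<Rightarrow> 'b) set" where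
  "bijections A B = {\<sigma> \<in> extensional A. bij_betw \<sigma> A B}"

definition FS :: "'a pair_pre_digraph \<Rightarrow> 'b pair_pre_digraph \<Rightarrow> ('a \<Rightarrow> 'b) pair_pre_digraph" where
  "FS X Y =
    \<lparr> pverts = bijections (pverts X) (pverts Y),
      parcs = {(\<sigma>, \<tau>).
        \<sigma> \<in> bijections (pverts X) (pverts Y) \<and> \<tau> \<in> bijections (pverts X) (pverts Y) \<and>
        (\<exists>a b. {a, b} \<in> edges X \<and> {\<sigma> a, \<sigma> b} \<in> edges Y \<and> \<tau> a = \<sigma> b \<and> \<tau> b = \<sigma> a \<and>
               (\<forall>c \<in> pverts X - {a, b}. \<tau> c = \<sigma> c))} \<rparr>"

definition graph_component :: "('a, 'b) pre_digraph \<Rightarrow> ('a, 'b) pre_digraph \<Rightarrow> bool" where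
  "graph_component G H \<longleftrightarrow> pre_digraph.max_subgraph G Digraph_Component.connected H"

text \<open>
  With unit weights, the library's \<open>\<mu>\<close> is the length of a shortest walk, and \<open>\<infinity>\<close>
  if there is none.
\<close>

definition graph_diameter :: "('a, 'b) pre_digraph \<Rightarrow> ereal" where
  "graph_diameter G = (SUP u \<in> verts G. SUP v \<in> verts G. wf_digraph.\<mu> G (\<lambda>_. 1) u v)"


lemma edges_iff:
  assumes "pair_sym_digraph G"
  shows "{u, v} \<in> edges G \<longleftrightarrow> (u, v) \<in> parcs G"
proof -
  interpret pair_sym_digraph G by fact
  have "(a, b) \<in> parcs G \<Longrightarrow> (b, a) \<in> parcs G" for a b
    using pair_sym_arcs by (auto simp: symmetric_def sym_def)
  then show ?thesis by (auto simp: edges_def doubleton_eq_iff)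
qed

lemma pair_graph_path_graph: "pair_graph (path_graph n)"
proof -
  have "parcs (path_graph n) \<subseteq> {1..n} \<times> {1..n}" by (auto simp: path_graph_def)
  then have "finite (parcs (path_graph n))" by (rule finite_subset) auto
  then show ?thesis
    by unfold_locales (auto simp: path_graph_def symmetric_def intro!: symI)
qed

lemma pair_graph_FS:
  assumes "pair_graph X" "pair_graph Y"
  shows "pair_graph (FS X Y)"
proof -
  interpret X: pair_graph X by fact
  interpret Y: pair_graph Y by fact
  let ?B = "bijections (pverts X) (pverts Y)"
  have "?B \<subseteq> (\<Pi>\<^sub>E x \<in> pverts X. pverts Y)"
    by (auto simp: bijections_def PiE_def dest: bij_betw_apply)
  then have fin: "finite ?B"
    by (rule finite_subset) (simp add: finite_PiE X.pair_finite_verts Y.pair_finite_verts)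
  have "parcs (FS X Y) \<subseteq> ?B \<times> ?B" by (auto simp: FS_def)
  then have fin_arcs: "finite (parcs (FS X Y))"
    by (rule finite_subset) (simp add: fin)
  have sym: "sym (parcs (FS X Y))"
  proof (rule symI)
    fix \<sigma> \<tau> assume "(\<sigma>, \<tau>) \<in> parcs (FS X Y)"
    then obtain a b where
      "\<sigma> \<in> ?B" "\<tau> \<in> ?B" "{a, b} \<in> edges X" "{\<sigma> a, \<sigma> b} \<in> edges Y" "\<tau> a = \<sigma> b" "\<tau> b = \<sigma> a"
      "\<forall>c \<in> pverts X - {a, b}. \<tau> c = \<sigma> c"
      by (auto simp: FS_def)
    moreover from this have "{\<tau> a, \<tau> b} \<in> edges Y" by (simp add: insert_commute)
    ultimately show "(\<tau>, \<sigma>) \<in> parcs (FS X Y)"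
      unfolding FS_def by simp metis
  qed
  have loopfree: "\<sigma> \<noteq> \<tau>" if "(\<sigma>, \<tau>) \<in> parcs (FS X Y)" for \<sigma> \<tau>
  proof -
    from that obtain a b where ab: "{\<sigma> a, \<sigma> b} \<in> edges Y" "\<tau> a = \<sigma> b"
      unfolding FS_def by force
    then have "(\<sigma> a, \<sigma> b) \<in> parcs Y"
      using edges_iff[OF Y.pair_sym_digraph_axioms] by blast
    then have "\<sigma> a \<noteq> \<sigma> b" using Y.pair_no_loops by fastforce
    then show ?thesis using ab by metis
  qed
  show ?thesis
  proof unfold_locales
    fix e assume e: "e \<in> parcs (FS X Y)"
    then show "fst e \<in> pverts (FS X Y)" "snd e \<in> pverts (FS X Y)" by (auto simp: FS_def)
    show "fst e \<noteq> snd e" using e loopfree by (cases e) auto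
  next
    show "finite (pverts (FS X Y))" using fin by (simp add: FS_def)
    show "finite (parcs (FS X Y))" by (rule fin_arcs)
    show "symmetric (FS X Y)" using sym by (simp add: symmetric_def)
  qed
qed

text \<open>
  For an undirected (symmetric) graph the connected components are the strongly connected
  ones, so that the library's results on \<^const>\<open>pre_digraph.sccs\<close> apply.
\<close>

lemma graph_component_iff_sccs:
  assumes "sym_digraph G"
  shows "graph_component G H \<longleftrightarrow> H \<in> pre_digraph.sccs G"
proof -
  interpret sym_digraph G by fact
  have sc_iff: "strongly_connected (G \<restriction> S) \<longleftrightarrow> Digraph_Component.connected (G \<restriction> S)"
    if "S \<subseteq> verts G" for S
  proof
    interpret I: wf_digraph "G \<restriction> S" by (rule wellformed_induce_subgraph)
    show "Digraph_Component.connected (G \<restriction> S)" if "strongly_connected (G \<restriction> S)"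
      using that I.reachable_mk_symmetricI
      unfolding Digraph_Component.connected_def strongly_connected_def by auto
    have "symmetric (G \<restriction> S)"
      using sym_arcs induced_induce[OF \<open>S \<subseteq> verts G\<close>] by (rule induced_graph_imp_symmetric)
    then show "strongly_connected (G \<restriction> S)" if "Digraph_Component.connected (G \<restriction> S)"
      using that by (rule I.symmetric_connected_imp_strongly_connected)
  qed
  have mono: "arc_mono (Digraph_Component.connected :: ('a, 'b) pre_digraph \<Rightarrow> bool)"
    unfolding arc_mono_def
  proof (intro allI impI, elim conjE)
    fix H1 H2 :: "('a, 'b) pre_digraph"
    assume *: "Digraph_Component.connected H1" "subgraph H1 H2" "verts H1 = verts H2"
    then have "wf_digraph H2" "spanning H1 H2" by (auto simp: subgraph_def spanning_def)
    then show "Digraph_Component.connected H2"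
      using * by (metis wf_digraph.connected_spanning_imp_connected)
  qed
  have induced_eq: "H' = G \<restriction> verts H'" "verts H' \<subseteq> verts G" if "induced_subgraph H' G" for H'
    using that by (auto simp: induced_subgraph_def subgraph_def compatible_def induce_subgraph_def)
  have connected_induce: "Digraph_Component.connected (G \<restriction> verts H')"
    if "Digraph_Component.connected H'" "subgraph H' G" for H'
    using mono that subgraph_induce_subgraphI2[OF that(2)] unfolding arc_mono_def
    by (metis induce_subgraph_verts)
  have sc_imp: "Digraph_Component.connected H'" if "strongly_connected H'" "wf_digraph H'"
    for H' :: "('a, 'b) pre_digraph"
    using that wf_digraph.reachable_mk_symmetricI[OF that(2)]
    unfolding Digraph_Component.connected_def strongly_connected_def by auto
  show ?thesis
    unfolding graph_component_def sccs_altdef2 mem_Collect_eq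
  proof
    assume max: "max_subgraph Digraph_Component.connected H"
    then have ind: "induced_subgraph H G" using mono by (rule induced_subgraphI_arc_mono)
    have "strongly_connected H"
      using sc_iff[OF induced_eq(2)[OF ind]] induced_eq(1)[OF ind] max_subgraph_prop[OF max] by simp
    then show "max_subgraph strongly_connected H"
      using max sc_imp unfolding max_subgraph_def by (metis subgraph_def)
  next
    assume max: "max_subgraph strongly_connected H"
    then have sub: "subgraph H G" by (rule subgraphI_max_subgraph)
    show "max_subgraph Digraph_Component.connected H"
    proof (rule max_subgraphI)
      show "Digraph_Component.connected H"
        using max_subgraph_prop[OF max] sub sc_imp by (auto simp: subgraph_def)
      show "subgraph H G" by (rule sub)
      fix K assume K: "H \<noteq> K" "subgraph H K" "subgraph K G"
      show "\<not> Digraph_Component.connected K"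
      proof
        assume con: "Digraph_Component.connected K"
        let ?I = "G \<restriction> verts K"
        have "verts K \<subseteq> verts G" using K(3) by (rule subgraph_imp_subverts)
        then have "strongly_connected ?I" "subgraph ?I G"
          using con K(3) sc_iff connected_induce subgraph_induce_subgraphI by auto
        moreover have "subgraph K ?I" using K(3) by (rule subgraph_induce_subgraphI2)
        ultimately have "?I = H"
          using max subgraph_trans[OF K(2)] unfolding max_subgraph_def by blast
        then have "subgraph K H" using \<open>subgraph K ?I\<close> by simp
        with K show False by (auto simp: subgraph_def compatible_def)
      qed
    qed
  qed
qed

end

theory Submission
  imports Defs "HOL-Combinatorics.Permutations"
begin

text \<open>
  View a bijection \<open>\<sigma>\<close> as a linear order on \<open>V(Y)\<close>. An arc of
  \<open>FS(Path\<^sub>n, Y)\<close> swaps two consecutive elements that are adjacent in \<open>Y\<close>, so two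
  bijections in one component order every pair of nonadjacent vertices alike. Hence the pairs
  inverted between \<open>\<sigma>\<close> and \<open>\<tau>\<close> are edges of \<open>Y\<close>. As in bubble sort, if
  \<open>\<sigma> \<noteq> \<tau>\<close> then some consecutive pair of \<open>\<sigma>\<close> is inverted; swapping it is a legal move
  that leaves exactly one inversion fewer. So there is a walk whose length is the number of
  inversions, which is at most \<open>|E(Y)|\<close>.
\<close>

text \<open>Comparing values by position, instead of positions by value, gives orders of one common
  set for all bijections onto it. The inversions between \<sigma> and \<tau> are then the difference
  \<open>precedence n \<sigma> - precedence n \<tau>\<close>, with each inverted pair present once,
  oriented as in \<sigma>. Restricting to the image avoids the arbitrary values of
  \<open>the_inv_into\<close> elsewhere and keeps the relation finite.\<close>

definition precedence :: "nat \<Rightarrow> (nat \<Rightarrow> 'a) \<Rightarrow> ('a \<times> 'a) set" where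
  "precedence n \<sigma> = {(p, q). p \<in> \<sigma> ` {1..n} \<and> q \<in> \<sigma> ` {1..n} \<and>
    the_inv_into {1..n} \<sigma> p < the_inv_into {1..n} \<sigma> q}"

lemma precedence_iff:
  assumes "inj_on \<sigma> {1..n}" "k \<in> {1..n}" "l \<in> {1..n}"
  shows "(\<sigma> k, \<sigma> l) \<in> precedence n \<sigma> \<longleftrightarrow> k < l"
  using assms by (simp add: precedence_def the_inv_into_f_f del: atLeastAtMost_iff)

text \<open>No position lies strictly between \<open>i\<close> and \<open>Suc i\<close>, so
  exchanging their values affects no comparison with a third element.\<close>

lemma precedence_swap:
  assumes inj: "inj_on \<sigma> {1..n}" and i: "1 \<le> i" "i < n"
  shows "precedence n (\<sigma> \<circ> transpose i (Suc i)) =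
    insert (\<sigma> (Suc i), \<sigma> i) (precedence n \<sigma> - {(\<sigma> i, \<sigma> (Suc i))})"
    (is "_ = ?R")
proof (rule set_eqI)
  let ?t = "transpose i (Suc i)" and ?S = "\<sigma> ` {1..n}"
  have i': "i \<in> {1..n}" "Suc i \<in> {1..n}" using i by simp_all
  then have perm: "?t permutes {1..n}" by (rule permutes_swap_id)
  have image: "(\<sigma> \<circ> ?t) ` {1..n} = ?S" using permutes_image[OF perm] by (metis image_comp)
  have inj': "inj_on (\<sigma> \<circ> ?t) {1..n}"
    by (rule comp_inj_on) (simp_all only: permutes_inj_on[OF perm] permutes_image[OF perm] inj)
  fix x
  show "x \<in> precedence n (\<sigma> \<circ> ?t) \<longleftrightarrow> x \<in> ?R"
  proof (cases "x \<in> ?S \<times> ?S")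
    case True
    then obtain k l where kl: "k \<in> {1..n}" "l \<in> {1..n}" and x: "x = (\<sigma> k, \<sigma> l)" by blast
    have "?t k \<in> {1..n}" "?t l \<in> {1..n}" using kl by (simp_all only: permutes_in_image[OF perm])
    \<comment> \<open>The transposition is its own inverse, so in the swapped order the values
      \<open>\<sigma> k\<close> and \<open>\<sigma> l\<close> sit at positions \<open>?t k\<close>
      and \<open>?t l\<close>.\<close>
    then have "x \<in> precedence n (\<sigma> \<circ> ?t) \<longleftrightarrow> ?t k < ?t l"
      using precedence_iff[OF inj', of "?t k" "?t l"] by (simp only: x o_apply transpose_involutory)
    also have "\<dots> \<longleftrightarrow> k = Suc i \<and> l = i \<or> k < l \<and> \<not> (k = i \<and> l = Suc i)"
      unfolding transpose_def by presburger
    also have "\<dots> \<longleftrightarrow> x \<in> ?R"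
      by (simp only: x insert_iff Diff_iff empty_iff prod.inject precedence_iff[OF inj kl]
          inj_on_eq_iff[OF inj kl(1) i'(1)] inj_on_eq_iff[OF inj kl(1) i'(2)]
          inj_on_eq_iff[OF inj kl(2) i'(1)] inj_on_eq_iff[OF inj kl(2) i'(2)] simp_thms)
    finally show ?thesis .
  next
    case False
    have "(\<sigma> (Suc i), \<sigma> i) \<in> ?S \<times> ?S" using i' by blast
    with False have "x \<notin> ?R" "x \<notin> precedence n (\<sigma> \<circ> ?t)"
      unfolding precedence_def image by blast+
    then show ?thesis by simp
  qed
qed

text \<open>Without a descent, \<open>f i - i\<close> is nondecreasing, but it is at least 0 at 1 and at most 0 at \<open>n\<close>.\<close>

lemma exists_descent:
  fixes f :: "nat \<Rightarrow> nat"
  assumes "f ` {1..n} \<subseteq> {1..n}" "k \<in> {1..n}" "f k \<noteq> k"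
  shows "\<exists>i. 1 \<le> i \<and> i < n \<and> f (Suc i) \<le> f i"
proof (rule ccontr)
  assume "\<not> ?thesis"
  then have less: "f i < f (Suc i)" if "1 \<le> i" "i < n" for i
    using that by (meson not_le)
  have "i \<le> f i" if "1 \<le> i" "i \<le> n" for i
    using that
  proof (induction i rule: dec_induct)
    case base
    then have "1 \<in> {1..n}" by simp
    then have "f 1 \<in> {1..n}" using assms(1) by blast
    then show ?case by simp
  next
    case (step i)
    then show ?case using less[of i] by simp
  qed
  moreover have "f i \<le> i" if "i \<le> n" "1 \<le> i" for i
    using that
  proof (induction i rule: inc_induct)
    case base
    then have "n \<in> {1..n}" by simp
    then have "f n \<in> {1..n}" using assms(1) by blast
    then show ?case by simp
  next
    case (step i)
    then show ?case using less[of i] by simp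
  qed
  ultimately show False using assms(2,3) by (simp add: le_antisym)
qed

text \<open>Turns arcs into right composition with adjacent transpositions, the form that
  \<open>precedence_swap\<close> speaks of. Equality of functions, beyond agreement on
  \<open>{1..n}\<close>, comes from extensionality.\<close>

lemma arc_FS_path_iff:
  assumes Y: "pair_sym_digraph Y" and \<sigma>: "\<sigma> \<in> bijections {1..n} (pverts Y)"
  shows "(\<sigma>, \<tau>) \<in> parcs (FS (path_graph n) Y) \<longleftrightarrow>
    (\<exists>i. 1 \<le> i \<and> i < n \<and> (\<sigma> i, \<sigma> (Suc i)) \<in> parcs Y \<and> \<tau> = \<sigma> \<circ> transpose i (Suc i))"
    (is "?L \<longleftrightarrow> ?R")
proof -
  have "pair_sym_digraph (path_graph n)"
    using pair_graph_path_graph unfolding pair_graph_def pair_pseudo_graph_def by blast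
  then have edge_P: "{a, b} \<in> edges (path_graph n) \<longleftrightarrow>
      a \<in> {1..n} \<and> b \<in> {1..n} \<and> (b = Suc a \<or> a = Suc b)" for a b
    by (simp add: edges_iff) (simp add: path_graph_def)
  note edge_Y = edges_iff[OF Y]
  have V: "pverts (path_graph n) = {1..n}" by (simp add: path_graph_def)
  have swap: "\<sigma> \<circ> transpose i (Suc i) \<in> bijections {1..n} (pverts Y)" if "1 \<le> i" "i < n" for i
  proof -
    have perm: "transpose i (Suc i) permutes {1..n}"
      by (rule permutes_swap_id) (use that in simp_all)
    have "bij_betw (\<sigma> \<circ> transpose i (Suc i)) {1..n} (pverts Y)"
      by (rule bij_betw_trans[OF permutes_imp_bij[OF perm]]) (use \<sigma> in \<open>simp add: bijections_def\<close>)
    \<comment> \<open>The transposition fixes every point outside \<open>{1..n}\<close>, so the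
      value \<open>undefined\<close> there survives the composition.\<close>
    moreover have "\<sigma> \<circ> transpose i (Suc i) \<in> extensional {1..n}"
      using \<sigma> permutes_not_in[OF perm] unfolding bijections_def extensional_def by simp
    ultimately show ?thesis unfolding bijections_def by blast
  qed
  have arc_iff: "?L \<longleftrightarrow> \<tau> \<in> bijections {1..n} (pverts Y) \<and> (\<exists>a b. {a, b} \<in> edges (path_graph n) \<and>
      {\<sigma> a, \<sigma> b} \<in> edges Y \<and> \<tau> a = \<sigma> b \<and> \<tau> b = \<sigma> a \<and> (\<forall>c \<in> {1..n} - {a, b}. \<tau> c = \<sigma> c))"
    using \<sigma> by (simp add: FS_def V del: insert_iff)
  show ?thesis
  proof
    assume ?L
    then obtain a b where ab: "{a, b} \<in> edges (path_graph n)" "{\<sigma> a, \<sigma> b} \<in> edges Y"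
        "\<tau> a = \<sigma> b" "\<tau> b = \<sigma> a" "\<forall>c \<in> {1..n} - {a, b}. \<tau> c = \<sigma> c"
      and \<tau>: "\<tau> \<in> bijections {1..n} (pverts Y)"
      unfolding arc_iff by blast
    \<comment> \<open>The path edge may run upward or downward from \<open>a\<close> to
      \<open>b\<close>; \<open>i\<close> is its smaller endpoint. The swap conditions are symmetric
      in \<open>a\<close> and \<open>b\<close>.\<close>
    obtain i where i: "1 \<le> i" "i < n" "{a, b} = {i, Suc i}" "{\<sigma> a, \<sigma> b} = {\<sigma> i, \<sigma> (Suc i)}"
        "\<tau> i = \<sigma> (Suc i)" "\<tau> (Suc i) = \<sigma> i"
      using ab(1,3,4) that[of a] that[of b] unfolding edge_P
      by (auto simp only: insert_commute atLeastAtMost_iff Suc_le_eq)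
    have "\<tau> = \<sigma> \<circ> transpose i (Suc i)"
    proof (rule extensionalityI)
      show "\<tau> \<in> extensional {1..n}" "\<sigma> \<circ> transpose i (Suc i) \<in> extensional {1..n}"
        using \<tau> swap[OF i(1,2)] by (simp_all add: bijections_def)
      fix c assume "c \<in> {1..n}"
      then show "\<tau> c = (\<sigma> \<circ> transpose i (Suc i)) c"
        using ab(5) i(3,5,6) by (simp add: transpose_def)
    qed
    moreover have "(\<sigma> i, \<sigma> (Suc i)) \<in> parcs Y"
      using ab(2) unfolding i(4) edge_Y .
    ultimately show ?R using i by blast
  next
    assume ?R
    then obtain i where i: "1 \<le> i" "i < n" "(\<sigma> i, \<sigma> (Suc i)) \<in> parcs Y"
        and \<tau>: "\<tau> = \<sigma> \<circ> transpose i (Suc i)" by blast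
    have "{i, Suc i} \<in> edges (path_graph n)" unfolding edge_P using i by simp
    moreover have "\<forall>c \<in> {1..n} - {i, Suc i}. \<tau> c = \<sigma> c" "\<tau> i = \<sigma> (Suc i)" "\<tau> (Suc i) = \<sigma> i"
      unfolding \<tau> by simp_all
    ultimately show ?L
      unfolding arc_iff edge_Y using i(3) swap[OF i(1,2)] \<tau> by blast
  qed
qed

theorem theorem3p3:
  fixes n :: nat and Y :: "'a pair_pre_digraph"
    and C :: "(nat \<Rightarrow> 'a, (nat \<Rightarrow> 'a) \<times> (nat \<Rightarrow> 'a)) pre_digraph"
  assumes "pair_graph Y" and "card (pverts Y) = n"
    and "graph_component (with_proj (FS (path_graph n) Y)) C"
  shows "graph_diameter C \<le> ereal (real (card (edges Y)))"
proof -
  let ?F = "FS (path_graph n) Y"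
  interpret Y: pair_graph Y by fact
  interpret F: pair_graph ?F
    using pair_graph_path_graph assms(1) by (rule pair_graph_FS)
  have scc: "C \<in> F.sccs"
    using assms(3) graph_component_iff_sccs F.sym_digraph_axioms by blast
  then have ind: "induced_subgraph C ?F" by blast
  then interpret C: wf_digraph C by (auto simp: induced_subgraph_def subgraph_def)
  have ends: "tail C = fst" "head C = snd"
    using ind by (auto simp: induced_subgraph_def subgraph_def compatible_def)
  have bij: "\<sigma> \<in> bijections {1..n} (pverts Y)" if "\<sigma> \<in> verts C" for \<sigma>
    using that ind by (auto simp: induced_subgraph_def subgraph_def FS_def path_graph_def)
  have inj: "inj_on \<sigma> {1..n}" if "\<sigma> \<in> verts C" for \<sigma>
    using bij[OF that] by (simp add: bijections_def bij_betw_def)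
  have scc_verts: "verts C \<in> F.sccs_verts" using scc by (intro F.in_sccs_vertsI_sccs) auto
  \<comment> \<open>Moves cannot leave the component: arcs are reversible, so their ends reach each
    other, and an induced subgraph keeps the arc itself.\<close>
  have closed: "\<tau> \<in> verts C" "(\<sigma>, \<tau>) \<in> arcs C" if "\<sigma> \<in> verts C" "(\<sigma>, \<tau>) \<in> parcs ?F" for \<sigma> \<tau>
  proof -
    have "\<sigma> \<rightarrow>\<^sup>*\<^bsub>with_proj ?F\<^esub> \<tau>" "\<tau> \<rightarrow>\<^sup>*\<^bsub>with_proj ?F\<^esub> \<sigma>"
      using that(2) F.symmetric_reachable' by auto
    then show "\<tau> \<in> verts C" using that(1) scc_verts unfolding F.sccs_verts_def by blast
    then show "(\<sigma>, \<tau>) \<in> arcs C" using that ind by (auto simp: induced_subgraph_def)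
  qed
  have inversions: "precedence n \<sigma> - precedence n \<tau> \<subseteq> parcs Y"
    if "\<sigma> \<in> verts C" "\<tau> \<in> verts C" for \<sigma> \<tau>
  proof -
    have "\<sigma> \<rightarrow>\<^sup>*\<^bsub>with_proj ?F\<^esub> \<tau>" using that scc_verts unfolding F.sccs_verts_def by blast
    then show ?thesis
    proof (induction rule: F.reachable_induct)
      case base
      then show ?case by simp
    next
      case (step \<tau> \<upsilon>)
      then have arc: "(\<tau>, \<upsilon>) \<in> parcs ?F" by auto
      then have \<tau>: "\<tau> \<in> bijections {1..n} (pverts Y)" by (auto simp: FS_def path_graph_def)
      then have "inj_on \<tau> {1..n}" by (simp add: bijections_def bij_betw_def)
      moreover obtain i where "1 \<le> i" "i < n" "(\<tau> i, \<tau> (Suc i)) \<in> parcs Y"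
          "\<upsilon> = \<tau> \<circ> transpose i (Suc i)"
        using arc unfolding arc_FS_path_iff[OF Y.pair_sym_digraph_axioms \<tau>] by blast
      ultimately have "precedence n \<tau> - precedence n \<upsilon> \<subseteq> parcs Y"
        using precedence_swap[of \<tau> n i] by auto
      \<comment> \<open>A pair of \<open>precedence n \<sigma>\<close> missing at \<upsilon> is
        either already missing at \<tau>, or is lost in the last swap and hence is the swapped
        arc.\<close>
      then show ?case using step.IH by blast
    qed
  qed
  have card_inversions: "card (precedence n \<sigma> - precedence n \<tau>) \<le> card (edges Y)"
    if "\<sigma> \<in> verts C" "\<tau> \<in> verts C" for \<sigma> \<tau>
  proof (rule card_inj_on_le)
    let ?f = "\<lambda>(p, q). {p, q}"
    \<comment> \<open>A strict order never contains both \<open>(p, q)\<close> and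
      \<open>(q, p)\<close>. So each edge is hit at most once, although \<open>parcs Y\<close> holds
      both of its arcs.\<close>
    show "inj_on ?f (precedence n \<sigma> - precedence n \<tau>)"
      by (auto simp: inj_on_def doubleton_eq_iff precedence_def)
    show "?f ` (precedence n \<sigma> - precedence n \<tau>) \<subseteq> edges Y"
      using inversions[OF that] by (auto simp: edges_def)
    have "edges Y = ?f ` parcs Y" by (auto simp: edges_def)
    then show "finite (edges Y)" using Y.pair_finite_arcs by simp
  qed
  have walk: "\<exists>p. C.awalk \<sigma> p \<tau> \<and> length p = card (precedence n \<sigma> - precedence n \<tau>)"
    if \<sigma>: "\<sigma> \<in> verts C" and \<tau>: "\<tau> \<in> verts C" for \<sigma> \<tau>
    using \<sigma>
  proof (induction "card (precedence n \<sigma> - precedence n \<tau>)" arbitrary: \<sigma> rule: less_induct)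
    case less
    note \<sigma> = \<open>\<sigma> \<in> verts C\<close>
    show ?case
    proof (cases "\<sigma> = \<tau>")
      case True
      with \<sigma> show ?thesis by (auto simp: C.awalk_Nil_iff)
    next
      case False
      \<comment> \<open>The position in \<tau> of the element at position \<open>k\<close> of
        \<sigma>. A descent of \<open>?f\<close> is a consecutive pair of \<sigma> that \<tau>
        orders the other way.\<close>
      let ?f = "\<lambda>k. the_inv_into {1..n} \<tau> (\<sigma> k)"
      have same_range: "\<sigma> ` {1..n} = \<tau> ` {1..n}"
        using bij[OF \<sigma>] bij[OF \<tau>] by (simp add: bijections_def bij_betw_def)
      have \<tau>_f: "\<tau> (?f k) = \<sigma> k" "?f k \<in> {1..n}" if "k \<in> {1..n}" for k
      proof -
        have "\<sigma> k \<in> \<tau> ` {1..n}" using same_range that by blast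
        then show "\<tau> (?f k) = \<sigma> k" "?f k \<in> {1..n}"
          using f_the_inv_into_f the_inv_into_into inj[OF \<tau>] by fast+
      qed
      \<comment> \<open>Both functions are \<open>undefined\<close> off \<open>{1..n}\<close>, so
        being distinct they differ inside it.\<close>
      obtain k where "k \<in> {1..n}" "\<sigma> k \<noteq> \<tau> k"
        using False bij[OF \<sigma>] bij[OF \<tau>] extensionalityI[of \<sigma> "{1..n}" \<tau>]
        unfolding bijections_def by blast
      then have "?f k \<noteq> k" using \<tau>_f(1) by metis
      then obtain i where i: "1 \<le> i" "i < n" and descent: "?f (Suc i) \<le> ?f i"
        using exists_descent[of ?f n k] \<open>k \<in> {1..n}\<close> \<tau>_f(2) by blast
      have "?f (Suc i) \<noteq> ?f i"
        using \<tau>_f(1)[of i] \<tau>_f(1)[of "Suc i"] inj_onD[OF inj[OF \<sigma>], of i "Suc i"] i by auto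
      then have inverted: "(\<sigma> (Suc i), \<sigma> i) \<in> precedence n \<tau>" "(\<sigma> i, \<sigma> (Suc i)) \<notin> precedence n \<tau>"
        using descent i unfolding precedence_def same_range[symmetric] by auto
      have finite_precedence: "finite (precedence n \<sigma>)"
        by (rule finite_subset[of _ "\<sigma> ` {1..n} \<times> \<sigma> ` {1..n}"]) (auto simp: precedence_def)
      have mem: "(\<sigma> i, \<sigma> (Suc i)) \<in> precedence n \<sigma>"
        using precedence_iff[OF inj[OF \<sigma>], of i "Suc i"] i by simp
      define \<rho> where "\<rho> = \<sigma> \<circ> transpose i (Suc i)"
      have "(\<sigma> i, \<sigma> (Suc i)) \<in> parcs Y" using inversions[OF \<sigma> \<tau>] mem inverted(2) by blast
      then have "(\<sigma>, \<rho>) \<in> parcs ?F"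
        unfolding arc_FS_path_iff[OF Y.pair_sym_digraph_axioms bij[OF \<sigma>]] \<rho>_def using i by blast
      then have \<rho>: "\<rho> \<in> verts C" and arc: "(\<sigma>, \<rho>) \<in> arcs C"
        using closed[OF \<sigma>] by blast+
      \<comment> \<open>The pair that the swap adds belongs to \<open>precedence n \<tau>\<close>,
        so subtracting removes it again; only the loss of the swapped pair remains.\<close>
      have "precedence n \<rho> - precedence n \<tau> =
          precedence n \<sigma> - precedence n \<tau> - {(\<sigma> i, \<sigma> (Suc i))}"
        using precedence_swap[OF inj[OF \<sigma>] i] inverted(1) unfolding \<rho>_def by auto
      then have card: "card (precedence n \<sigma> - precedence n \<tau>) =
          Suc (card (precedence n \<rho> - precedence n \<tau>))"
        using mem inverted(2) finite_precedence
          card_Suc_Diff1[of "precedence n \<sigma> - precedence n \<tau>"] by simp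
      obtain p where "C.awalk \<rho> p \<tau>" "length p = card (precedence n \<rho> - precedence n \<tau>)"
        using less.hyps[of \<rho>] card \<rho> by auto
      then have "C.awalk \<sigma> ((\<sigma>, \<rho>) # p) \<tau>"
          "length ((\<sigma>, \<rho>) # p) = card (precedence n \<sigma> - precedence n \<tau>)"
        using arc card by (auto simp: C.awalk_Cons_iff ends)
      then show ?thesis by blast
    qed
  qed
  have "C.\<mu> (\<lambda>_. 1) \<sigma> \<tau> \<le> ereal (real (card (edges Y)))"
    if \<sigma>: "\<sigma> \<in> verts C" and \<tau>: "\<tau> \<in> verts C" for \<sigma> \<tau>
  proof -
    obtain p where p: "C.awalk \<sigma> p \<tau>" "length p = card (precedence n \<sigma> - precedence n \<tau>)"
      using walk[OF \<sigma> \<tau>] by blast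
    \<comment> \<open>\<open>\<mu>\<close> is an infimum over walks, so the single walk
      \<open>p\<close> bounds it; under unit weights its cost is its length.\<close>
    have "C.\<mu> (\<lambda>_. 1) \<sigma> \<tau> \<le> ereal (C.awalk_cost (\<lambda>_. 1) p)"
      using p(1) by (rule C.min_cost_le_walk_cost)
    also have "C.awalk_cost (\<lambda>_. 1) p = real (length p)"
      by (simp add: C.awalk_cost_def sum_list_triv)
    also have "length p \<le> card (edges Y)"
      using card_inversions[OF \<sigma> \<tau>] p(2) by simp
    finally show ?thesis by simp
  qed
  then show ?thesis unfolding graph_diameter_def by (intro SUP_least)
qed

end
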